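(* Let $(X,\mathcal{F},\mu)$ be a complete $\sigma$-finite measure space, let $\mathcal{A}\subseteq\mathcal{F}$ be a $\sigma$-subalgebra such that $(X,\mathcal{A},\mu|_{\mathcal{A}})$ is $\sigma$-finite, and let $E=E^{\mathcal{A}}$ be the associated conditional expectation. Let $w,u\in\mathcal{D}(E)$ with $E(|u|^2)\in L^\infty(\mathcal{A})$, let $T=M_wEM_u$ be a bounded operator on $L^2(\mathcal{F})$, and let $u\ge 0$. If $S\in Q_T$ and $E(u)\ge\delta$ for some $\delta>0$, then $EM_u$ majorizes $S$.
   Context: $L^2(\mathcal{F})=L^2(X,\mathcal{F},\mu)$; $L^0(\mathcal{F})$ (resp. $L^0(\mathcal{A})$) is the space of $\mathcal{F}$-measurable (resp. $\mathcal{A}$-measurable) functions on $X$; statements about functions hold up to null sets. For nonnegative $f$ and for $f\in L^2(\mathcal{F})$, $Ef$ is the unique $\mathcal{A}$-measurable function with $\int_A Ef\,d\mu=\int_A f\,d\mu$ for all $A\in\mathcal{A}$; $E$ extends to $\mathcal{D}(E)=\{f\in L^0(\mathcal{F}): E(|f|)\in L^0(\mathcal{A})\}$. The weighted conditional expectation operator is $M_wEM_u: f\mapsto wE(uf)$ (and $EM_u: f\mapsto E(uf)$). $\mathcal{B}(\mathcal{H})$ denotes the bounded linear operators on a Hilbert space $\mathcal{H}$. For $T\in\mathcal{B}(\mathcal{H})$ with spectral radius $r(T)$ and $m\ge 1$, put $d_m=\frac{1}{1/m+r(T)}$ and $R_m=R_m(T)=\left(\sum_{n=0}^\infty d_m^{2n}T^{*n}T^n\right)^{1/2}$,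 a positive invertible operator. Define $Q_T=\{S\in\mathcal{B}(\mathcal{H}):\|R_mSR_m^{-1}\|\to 0 \text{ as } m\to\infty\}$. For bounded operators $A,B$ on a Banach space $Y$, $A$ majorizes $B$ if there exists $M>0$ such that $\|By\|\le M\|Ay\|$ for all $y\in Y$. *)

theory Defs
  imports "HOL-Probability.Probability" "HOL-Library.Complex_Order"
begin

text \<open>
  The complex Hilbert space \<open>L\<^sup>2(M)\<close> is handled through representatives: its vectors are the
  square-integrable functions, its operators are maps between such functions, and every
  identity between vectors is asserted almost everywhere.
\<close>

definition L2 :: "'a measure \<Rightarrow> ('a \<Rightarrow> complex) set" where
  "L2 M = {f \<in> borel_measurable M. integrable M (\<lambda>x. (cmod (f x))\<^sup>2)}"

definition L2_inner :: "'a measure \<Rightarrow> ('a \<Rightarrow> complex) \<Rightarrow> ('a \<Rightarrow> complex) \<Rightarrow> complex" where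
  "L2_inner M f g = (\<integral>x. f x * cnj (g x) \<partial>M)"

definition L2_norm :: "'a measure \<Rightarrow> ('a \<Rightarrow> complex) \<Rightarrow> real" where
  "L2_norm M f = sqrt (\<integral>x. (cmod (f x))\<^sup>2 \<partial>M)"

type_synonym 'a operator = "('a \<Rightarrow> complex) \<Rightarrow> ('a \<Rightarrow> complex)"

text \<open>
  Compatibility with almost everywhere equality is not listed separately: it follows from
  linearity and boundedness.
\<close>

definition bounded_op :: "'a measure \<Rightarrow> 'a operator \<Rightarrow> bool" where
  "bounded_op M T \<longleftrightarrow>
     (\<forall>f\<in>L2 M. T f \<in> L2 M) \<and>
     (\<forall>f\<in>L2 M. \<forall>g\<in>L2 M. AE x in M. T (\<lambda>y. f y + g y) x = T f x + T g x) \<and>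
     (\<forall>c. \<forall>f\<in>L2 M. AE x in M. T (\<lambda>y. c * f y) x = c * T f x) \<and>
     (\<exists>K. \<forall>f\<in>L2 M. L2_norm M (T f) \<le> K * L2_norm M f)"

definition op_norm :: "'a measure \<Rightarrow> 'a operator \<Rightarrow> real" where
  "op_norm M T = (SUP f\<in>{f \<in> L2 M. L2_norm M f \<le> 1}. L2_norm M (T f))"

definition is_adjoint :: "'a measure \<Rightarrow> 'a operator \<Rightarrow> 'a operator \<Rightarrow> bool" where
  "is_adjoint M T T' \<longleftrightarrow> bounded_op M T' \<and>
     (\<forall>f\<in>L2 M. \<forall>g\<in>L2 M. L2_inner M (T f) g = L2_inner M f (T' g))"

definition is_inverse :: "'a measure \<Rightarrow> 'a operator \<Rightarrow> 'a operator \<Rightarrow> bool" where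
  "is_inverse M T T' \<longleftrightarrow> bounded_op M T' \<and>
     (\<forall>f\<in>L2 M. (AE x in M. T (T' f) x = f x) \<and> (AE x in M. T' (T f) x = f x))"

text \<open>The order on \<^typ>\<open>complex\<close> used here makes \<open>0 \<le> z\<close> say that \<open>z\<close> is real and nonnegative.\<close>

definition positive_op :: "'a measure \<Rightarrow> 'a operator \<Rightarrow> bool" where
  "positive_op M T \<longleftrightarrow> bounded_op M T \<and> (\<forall>f\<in>L2 M. 0 \<le> L2_inner M (T f) f)"

definition op_spectrum :: "'a measure \<Rightarrow> 'a operator \<Rightarrow> complex set" where
  "op_spectrum M T = {c. \<nexists>B. is_inverse M (\<lambda>f x. c * f x - T f x) B}"

text \<open>
  The inserted \<open>0\<close> only matters when \<open>L\<^sup>2(M)\<close> is the zero space: otherwise the spectrum is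
  nonempty.
\<close>

definition spec_radius :: "'a measure \<Rightarrow> 'a operator \<Rightarrow> real" where
  "spec_radius M T = Sup (insert 0 (cmod ` op_spectrum M T))"

definition d_coeff :: "'a measure \<Rightarrow> 'a operator \<Rightarrow> nat \<Rightarrow> real" where
  "d_coeff M T m = 1 / (1 / real m + spec_radius M T)"

text \<open>
  \<open>is_R M T m R\<close> says that \<open>R\<close> is (a representative of) the positive square root of
  \<open>\<Sum>n. d\<^sub>m\<^sup>2\<^sup>n T\<^sup>*\<^sup>n T\<^sup>n\<close>, the series converging in operator norm. For bounded \<open>T\<close> and \<open>m \<ge> 1\<close>
  the adjoint, the sum, its positive square root and the inverse of the latter exist and are
  unique up to null sets, so the existential quantifiers below involve no choice.
\<close>

definition is_R :: "'a measure \<Rightarrow> 'a operator \<Rightarrow> nat \<Rightarrow> 'a operator \<Rightarrow> bool" where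
  "is_R M T m R \<longleftrightarrow> positive_op M R \<and>
     (\<exists>T'. is_adjoint M T T' \<and>
       (\<lambda>N. op_norm M (\<lambda>f x. R (R f) x -
          (\<Sum>n<N. of_real (d_coeff M T m ^ (2 * n)) * (T' ^^ n) ((T ^^ n) f) x)))
       \<longlonglongrightarrow> 0)"

definition Q_class :: "'a measure \<Rightarrow> 'a operator \<Rightarrow> 'a operator set" where
  "Q_class M T = {S. bounded_op M S \<and>
     (\<exists>R R'. (\<forall>m\<ge>1. is_R M T m (R m) \<and> is_inverse M (R m) (R' m)) \<and>
             (\<lambda>m. op_norm M (\<lambda>f. R m (S (R' m f)))) \<longlonglongrightarrow> 0)}"

definition majorizes :: "'a measure \<Rightarrow> 'a operator \<Rightarrow> 'a operator \<Rightarrow> bool" where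
  "majorizes M A B \<longleftrightarrow> (\<exists>K>0. \<forall>f\<in>L2 M. L2_norm M (B f) \<le> K * L2_norm M (A f))"

text \<open>
  \<^const>\<open>real_cond_exp\<close> is \<open>E f\<^sup>+ - E f\<^sup>-\<close>, hence it is the extended conditional expectation on
  the domain below, and not only on integrable functions.
\<close>

definition cond_exp_domain :: "'a measure \<Rightarrow> 'a measure \<Rightarrow> ('a \<Rightarrow> complex) set" where
  "cond_exp_domain M A =
     {f \<in> borel_measurable M. AE x in M. nn_cond_exp M A (\<lambda>y. ennreal (cmod (f y))) x < \<infinity>}"

definition complex_cond_exp :: "'a measure \<Rightarrow> 'a measure \<Rightarrow> ('a \<Rightarrow> complex) \<Rightarrow> 'a \<Rightarrow> complex" where
  "complex_cond_exp M A f x =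
     Complex (real_cond_exp M A (\<lambda>y. Re (f y)) x) (real_cond_exp M A (\<lambda>y. Im (f y)) x)"

definition EM :: "'a measure \<Rightarrow> 'a measure \<Rightarrow> ('a \<Rightarrow> complex) \<Rightarrow> 'a operator" where
  "EM M A u f = complex_cond_exp M A (\<lambda>y. u y * f y)"

definition MEM :: "'a measure \<Rightarrow> 'a measure \<Rightarrow> ('a \<Rightarrow> complex) \<Rightarrow> ('a \<Rightarrow> complex) \<Rightarrow> 'a operator" where
  "MEM M A w u f = (\<lambda>x. w x * EM M A u f x)"

end

theory Submission
  imports Defs
begin

text \<open>
  Two facts combine. First, every \<open>S\<close> in the class of \<open>T\<close> vanishes on the kernel of \<open>T\<close>. Indeed
  \<open>\<parallel>R\<^sub>m f\<parallel>\<^sup>2 = \<Sum>n. d\<^sub>m\<^sup>2\<^sup>n \<parallel>T\<^sup>n f\<parallel>\<^sup>2\<close> (\<open>is_R_norm_sums\<close>), so \<open>\<parallel>R\<^sub>m f\<parallel> \<ge> \<parallel>f\<parallel>\<close> always, with equality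
  when \<open>T f = 0\<close>. Hence \<open>\<parallel>S f\<parallel> \<le> \<parallel>R\<^sub>m S R\<^sub>m\<inverse>\<parallel> \<parallel>f\<parallel> \<rightarrow> 0\<close> for \<open>f\<close> in the kernel
  (\<open>Q_class_kernel\<close>).

  Second, since \<open>E(u) \<ge> \<delta>\<close>, the function \<open>g = E(u f) / E(u)\<close> satisfies \<open>E(u g) = E(u f)\<close> and
  \<open>\<parallel>g\<parallel> \<le> \<parallel>E(u f)\<parallel> / \<delta>\<close> (\<open>EM_bounded_lift\<close>); it is square-integrable because the conditional
  Cauchy-Schwarz inequality and the bound on \<open>E(\<bar>u\<bar>\<^sup>2)\<close> make \<open>E(u f)\<close> square-integrable.

  Now \<open>f - g\<close> lies in the kernel of \<open>f \<mapsto> E(u f)\<close>, hence in that of \<open>T = w E(u \<cdot>)\<close>, so \<open>S f = S g\<close>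
  and \<open>\<parallel>S f\<parallel> \<le> \<parallel>S\<parallel> \<parallel>g\<parallel> \<le> (\<parallel>S\<parallel> / \<delta>) \<parallel>E(u f)\<parallel>\<close>.
\<close>

section \<open>The inner product space of square-integrable functions\<close>

lemma L2_measurable [measurable_dest]: "f \<in> L2 M \<Longrightarrow> f \<in> borel_measurable M"
  by (simp add: L2_def)

lemma L2_integrable: "f \<in> L2 M \<Longrightarrow> integrable M (\<lambda>x. (cmod (f x))\<^sup>2)"
  by (simp add: L2_def)

lemma L2_dominated:
  assumes "f \<in> borel_measurable M" "integrable M h" "AE x in M. (cmod (f x))\<^sup>2 \<le> h x"
  shows "f \<in> L2 M"
proof -
  have "integrable M (\<lambda>x. (cmod (f x))\<^sup>2)"
    by (rule Bochner_Integration.integrable_bound[OF assms(2)]) (use assms in auto)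
  with assms(1) show ?thesis by (simp add: L2_def)
qed

lemma L2_add:
  assumes "f \<in> L2 M" "g \<in> L2 M"
  shows "(\<lambda>x. f x + g x) \<in> L2 M"
proof (rule L2_dominated)
  show "integrable M (\<lambda>x. 2 * (cmod (f x))\<^sup>2 + 2 * (cmod (g x))\<^sup>2)"
    using assms by (simp add: L2_integrable)
  show "AE x in M. (cmod (f x + g x))\<^sup>2 \<le> 2 * (cmod (f x))\<^sup>2 + 2 * (cmod (g x))\<^sup>2"
  proof (intro AE_I2)
    fix x
    have "(cmod (f x + g x))\<^sup>2 \<le> (cmod (f x) + cmod (g x))\<^sup>2"
      by (simp add: norm_triangle_ineq power_mono)
    also have "\<dots> \<le> 2 * (cmod (f x))\<^sup>2 + 2 * (cmod (g x))\<^sup>2"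
      using zero_le_power2[of "cmod (f x) - cmod (g x)"]
      by (simp add: power2_eq_square algebra_simps)
    finally show "(cmod (f x + g x))\<^sup>2 \<le> 2 * (cmod (f x))\<^sup>2 + 2 * (cmod (g x))\<^sup>2" .
  qed
qed (use assms in measurable)

lemma L2_cmult: "f \<in> L2 M \<Longrightarrow> (\<lambda>x. c * f x) \<in> L2 M"
  by (auto simp: L2_def norm_mult power_mult_distrib)

lemma L2_diff:
  assumes "f \<in> L2 M" "g \<in> L2 M"
  shows "(\<lambda>x. f x - g x) \<in> L2 M"
  using L2_add[OF assms(1) L2_cmult[OF assms(2), of "-1"]] by simp

lemma L2_zero: "(\<lambda>x. 0) \<in> L2 M"
  by (simp add: L2_def)

lemma L2_norm_nonneg [simp]: "0 \<le> L2_norm M f"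
  by (simp add: L2_norm_def)

lemma L2_norm_power2: "(L2_norm M f)\<^sup>2 = (\<integral>x. (cmod (f x))\<^sup>2 \<partial>M)"
  by (simp add: L2_norm_def)

lemma L2_norm_zero [simp]: "L2_norm M (\<lambda>x. 0) = 0"
  by (simp add: L2_norm_def)

lemma L2_norm_cong_AE:
  assumes "f \<in> L2 M" "g \<in> L2 M" "AE x in M. f x = g x"
  shows "L2_norm M f = L2_norm M g"
  unfolding L2_norm_def
  by (intro arg_cong[of _ _ sqrt] integral_cong_AE) (use assms L2_measurable in auto)

lemma L2_norm_cmult: "L2_norm M (\<lambda>x. c * f x) = cmod c * L2_norm M f"
  by (simp add: L2_norm_def norm_mult power_mult_distrib real_sqrt_mult)

lemma L2_norm_mono:
  assumes "g \<in> L2 M" "f \<in> L2 M" "AE x in M. cmod (f x) \<le> cmod (g x)"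
  shows "L2_norm M f \<le> L2_norm M g"
  unfolding L2_norm_def
  by (intro real_sqrt_le_mono integral_mono_AE L2_integrable assms)
    (use assms(3) in \<open>auto elim!: eventually_mono intro: power_mono\<close>)

lemma L2_norm_eq_0_iff_AE:
  assumes "f \<in> L2 M"
  shows "L2_norm M f = 0 \<longleftrightarrow> (AE x in M. f x = 0)"
  using integral_nonneg_eq_0_iff_AE[OF L2_integrable[OF assms]] by (simp add: L2_norm_def)

lemma borel_measurable_cnj [measurable (raw)]:
  assumes "g \<in> borel_measurable M"
  shows "(\<lambda>x. cnj (g x)) \<in> borel_measurable M"
  using assms by (rule measurable_compose) (intro borel_measurable_continuous_onI continuous_on_cnj continuous_on_id)

lemma L2_mult_integrable:
  assumes "f \<in> L2 M" "g \<in> L2 M"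
  shows "integrable M (\<lambda>x. f x * cnj (g x))"
proof (rule Bochner_Integration.integrable_bound)
  show "integrable M (\<lambda>x. (cmod (f x))\<^sup>2 + (cmod (g x))\<^sup>2)"
    using assms by (simp add: L2_integrable)
  show "AE x in M. norm (f x * cnj (g x)) \<le> norm ((cmod (f x))\<^sup>2 + (cmod (g x))\<^sup>2)"
  proof (intro AE_I2)
    fix x
    have "2 * (cmod (f x) * cmod (g x)) \<le> (cmod (f x))\<^sup>2 + (cmod (g x))\<^sup>2"
      using sum_squares_bound[of "cmod (f x)" "cmod (g x)"] by simp
    moreover have "0 \<le> cmod (f x) * cmod (g x)" by simp
    ultimately have "cmod (f x) * cmod (g x) \<le> (cmod (f x))\<^sup>2 + (cmod (g x))\<^sup>2"
      by linarith
    then show "norm (f x * cnj (g x)) \<le> norm ((cmod (f x))\<^sup>2 + (cmod (g x))\<^sup>2)"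
      by (simp add: norm_mult)
  qed
qed (use assms in measurable)

lemma L2_inner_add_left:
  assumes "f \<in> L2 M" "g \<in> L2 M" "h \<in> L2 M"
  shows "L2_inner M (\<lambda>x. f x + g x) h = L2_inner M f h + L2_inner M g h"
  using assms by (simp add: L2_inner_def distrib_right L2_mult_integrable)

lemma L2_inner_cmult_left: "L2_inner M (\<lambda>x. c * f x) h = c * L2_inner M f h"
  by (simp add: L2_inner_def mult.assoc)

lemma L2_inner_commute: "L2_inner M g f = cnj (L2_inner M f g)"
  unfolding L2_inner_def by (subst Bochner_Integration.integral_cnj[symmetric]) (simp add: mult.commute)

lemma L2_inner_add_right:
  assumes "f \<in> L2 M" "g \<in> L2 M" "h \<in> L2 M"
  shows "L2_inner M h (\<lambda>x. f x + g x) = L2_inner M h f + L2_inner M h g"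
  using L2_inner_add_left[OF assms] by (simp add: L2_inner_commute[of M h])

lemma L2_inner_cmult_right: "L2_inner M h (\<lambda>x. c * f x) = cnj c * L2_inner M h f"
  using L2_inner_cmult_left[of M c f h] by (simp add: L2_inner_commute[of M h])

lemma L2_inner_diff_right:
  assumes "f \<in> L2 M" "g \<in> L2 M" "h \<in> L2 M"
  shows "L2_inner M h (\<lambda>x. f x - g x) = L2_inner M h f - L2_inner M h g"
  using L2_inner_add_right[OF assms(1) L2_cmult[OF assms(2), of "-1"] assms(3)]
  by (simp add: L2_inner_cmult_right del: mult_minus_left)
    (simp add: L2_inner_cmult_right[of M h "-1" g, simplified])

lemma L2_sum:
  assumes "\<And>n. n < N \<Longrightarrow> f n \<in> L2 M"
  shows "(\<lambda>x. \<Sum>n<(N::nat). f n x) \<in> L2 M"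
  using assms by (induction N) (auto simp: L2_zero L2_add)

lemma L2_inner_sum_right:
  assumes "\<And>n. n < N \<Longrightarrow> f n \<in> L2 M" "h \<in> L2 M"
  shows "L2_inner M h (\<lambda>x. \<Sum>n<(N::nat). f n x) = (\<Sum>n<N. L2_inner M h (f n))"
  using assms(1)
proof (induction N)
  case 0
  show ?case by (simp add: L2_inner_def)
next
  case (Suc N)
  then show ?case using assms(2) by (simp add: L2_inner_add_right L2_sum)
qed

lemma L2_inner_self: "L2_inner M f f = complex_of_real ((L2_norm M f)\<^sup>2)"
  unfolding L2_inner_def L2_norm_power2
  by (subst integral_complex_of_real[symmetric]) (simp add: complex_norm_square del: integral_complex_of_real of_real_power)

lemma L2_Cauchy_Schwarz:
  assumes "f \<in> L2 M" "g \<in> L2 M"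
  shows "cmod (L2_inner M f g) \<le> L2_norm M f * L2_norm M g"
proof -
  let ?a = "L2_norm M f" and ?b = "L2_norm M g"
  define I where "I = (\<integral>x. cmod (f x * cnj (g x)) \<partial>M)"
  have int: "integrable M (\<lambda>x. cmod (f x * cnj (g x)))"
    using L2_mult_integrable[OF assms] by simp
  have le: "cmod (L2_inner M f g) \<le> I"
    unfolding L2_inner_def I_def by (rule integral_norm_bound)
  show ?thesis
  proof (cases "?a = 0 \<or> ?b = 0")
    case True
    then have "(AE x in M. f x = 0) \<or> (AE x in M. g x = 0)"
      using assms by (simp add: L2_norm_eq_0_iff_AE)
    then have "AE x in M. f x * cnj (g x) = 0" by auto
    then have "L2_inner M f g = 0"
      unfolding L2_inner_def by (rule integral_eq_zero_AE)
    then show ?thesis by simp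
  next
    case False
    then have pos: "?a * ?b > 0"
      by (metis L2_norm_nonneg less_eq_real_def mult_pos_pos)
    have "2 * (?a * ?b) * I = (\<integral>x. 2 * (?a * ?b) * cmod (f x * cnj (g x)) \<partial>M)"
      unfolding I_def by simp
    also have "\<dots> \<le> (\<integral>x. ?b\<^sup>2 * (cmod (f x))\<^sup>2 + ?a\<^sup>2 * (cmod (g x))\<^sup>2 \<partial>M)"
    proof (rule integral_mono)
      show "integrable M (\<lambda>x. ?b\<^sup>2 * (cmod (f x))\<^sup>2 + ?a\<^sup>2 * (cmod (g x))\<^sup>2)"
        using assms by (simp add: L2_integrable)
      show "integrable M (\<lambda>x. 2 * (?a * ?b) * cmod (f x * cnj (g x)))"
        using int by simp
      fix x
      show "2 * (?a * ?b) * cmod (f x * cnj (g x)) \<le> ?b\<^sup>2 * (cmod (f x))\<^sup>2 + ?a\<^sup>2 * (cmod (g x))\<^sup>2"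
        using sum_squares_bound[of "?b * cmod (f x)" "?a * cmod (g x)"]
        by (simp add: norm_mult power_mult_distrib ac_simps)
    qed
    also have "\<dots> = ?b\<^sup>2 * ?a\<^sup>2 + ?a\<^sup>2 * ?b\<^sup>2"
      using assms by (simp add: L2_integrable L2_norm_power2)
    also have "\<dots> = 2 * (?a * ?b) * (?a * ?b)"
      by (simp add: power2_eq_square)
    finally have "I \<le> ?a * ?b"
      using pos mult_le_cancel_left_pos[of "2 * (?a * ?b)" I "?a * ?b"] by (simp add: mult.assoc)
    with le show ?thesis by simp
  qed
qed

lemma L2_norm_triangle:
  assumes "f \<in> L2 M" "g \<in> L2 M"
  shows "L2_norm M (\<lambda>x. f x + g x) \<le> L2_norm M f + L2_norm M g"
proof (rule power2_le_imp_le)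
  let ?h = "\<lambda>x. f x + g x"
  have "complex_of_real ((L2_norm M ?h)\<^sup>2) = L2_inner M f f + L2_inner M f g + (L2_inner M g f + L2_inner M g g)"
    using assms L2_add[OF assms]
    by (simp add: L2_inner_self[symmetric] L2_inner_add_left L2_inner_add_right del: of_real_power)
  then have "(L2_norm M ?h)\<^sup>2 = (L2_norm M f)\<^sup>2 + Re (L2_inner M f g) + (Re (L2_inner M g f) + (L2_norm M g)\<^sup>2)"
    by (metis L2_inner_self Re_complex_of_real plus_complex.sel(1))
  also have "\<dots> \<le> (L2_norm M f)\<^sup>2 + L2_norm M f * L2_norm M g + (L2_norm M g * L2_norm M f + (L2_norm M g)\<^sup>2)"
    using L2_Cauchy_Schwarz[OF assms] L2_Cauchy_Schwarz[OF assms(2,1)]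
      complex_Re_le_cmod[of "L2_inner M f g"] complex_Re_le_cmod[of "L2_inner M g f"]
    by linarith
  finally show "(L2_norm M ?h)\<^sup>2 \<le> (L2_norm M f + L2_norm M g)\<^sup>2"
    by (simp add: power2_eq_square algebra_simps)
qed simp

section \<open>Bounded operators on the square-integrable functions\<close>

lemma bounded_op_L2: "bounded_op M T \<Longrightarrow> f \<in> L2 M \<Longrightarrow> T f \<in> L2 M"
  by (simp add: bounded_op_def)

lemma bounded_op_add_AE:
  "bounded_op M T \<Longrightarrow> f \<in> L2 M \<Longrightarrow> g \<in> L2 M \<Longrightarrow> AE x in M. T (\<lambda>y. f y + g y) x = T f x + T g x"
  by (simp add: bounded_op_def)

lemma bounded_op_cmult_AE:
  "bounded_op M T \<Longrightarrow> f \<in> L2 M \<Longrightarrow> AE x in M. T (\<lambda>y. c * f y) x = c * T f x"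
  by (simp add: bounded_op_def)

lemma bounded_op_boundE:
  assumes "bounded_op M T"
  obtains K where "K \<ge> 0" "\<And>f. f \<in> L2 M \<Longrightarrow> L2_norm M (T f) \<le> K * L2_norm M f"
proof -
  from assms obtain K where K: "\<forall>f\<in>L2 M. L2_norm M (T f) \<le> K * L2_norm M f"
    by (auto simp: bounded_op_def)
  show ?thesis
  proof
    show "0 \<le> \<bar>K\<bar>" by simp
    fix f assume "f \<in> L2 M"
    then have "L2_norm M (T f) \<le> K * L2_norm M f" using K by blast
    also have "\<dots> \<le> \<bar>K\<bar> * L2_norm M f" by (rule mult_right_mono) auto
    finally show "L2_norm M (T f) \<le> \<bar>K\<bar> * L2_norm M f" .
  qed
qed

lemma bounded_opI:
  assumes "\<And>f. f \<in> L2 M \<Longrightarrow> T f \<in> L2 M"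
    and "\<And>f g. f \<in> L2 M \<Longrightarrow> g \<in> L2 M \<Longrightarrow> AE x in M. T (\<lambda>y. f y + g y) x = T f x + T g x"
    and "\<And>c f. f \<in> L2 M \<Longrightarrow> AE x in M. T (\<lambda>y. c * f y) x = c * T f x"
    and "\<And>f. f \<in> L2 M \<Longrightarrow> L2_norm M (T f) \<le> K * L2_norm M f"
  shows "bounded_op M T"
  unfolding bounded_op_def using assms by blast

lemma bounded_op_diff_AE:
  assumes "bounded_op M T" "f \<in> L2 M" "g \<in> L2 M"
  shows "AE x in M. T (\<lambda>y. f y - g y) x = T f x - T g x"
  using bounded_op_add_AE[OF assms(1,2) L2_cmult[OF assms(3), of "-1"]]
    bounded_op_cmult_AE[OF assms(1,3), of "-1"]
  by auto

lemma bounded_op_eq_0_AE: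
  assumes "bounded_op M T" "f \<in> L2 M" "AE x in M. f x = 0"
  shows "AE x in M. T f x = 0"
proof -
  obtain K where "L2_norm M (T f) \<le> K * L2_norm M f"
    using bounded_op_boundE[OF assms(1)] assms(2) by metis
  moreover have "L2_norm M f = 0"
    using assms by (simp add: L2_norm_eq_0_iff_AE)
  ultimately have "L2_norm M (T f) = 0"
    using L2_norm_nonneg[of M "T f"] by simp
  then show ?thesis
    using assms by (simp add: L2_norm_eq_0_iff_AE bounded_op_L2)
qed

text \<open>
  Linearity and boundedness send a null function to a null function. This lets an identity
  between vectors, which holds only almost everywhere, pass through an operator.
\<close>

lemma bounded_op_cong_AE:
  assumes "bounded_op M T" "f \<in> L2 M" "g \<in> L2 M" "AE x in M. f x = g x"
  shows "AE x in M. T f x = T g x"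
proof -
  have "AE x in M. f x - g x = 0" using assms(4) by auto
  then have "AE x in M. T (\<lambda>y. f y - g y) x = 0"
    by (intro bounded_op_eq_0_AE[OF assms(1)] L2_diff assms)
  then show ?thesis using bounded_op_diff_AE[OF assms(1-3)] by auto
qed

lemma bounded_op_compose:
  assumes "bounded_op M S" "bounded_op M T"
  shows "bounded_op M (\<lambda>f. S (T f))"
proof -
  obtain K where K: "K \<ge> 0" "\<And>f. f \<in> L2 M \<Longrightarrow> L2_norm M (S f) \<le> K * L2_norm M f"
    using bounded_op_boundE[OF assms(1)] by metis
  obtain L where L: "L \<ge> 0" "\<And>f. f \<in> L2 M \<Longrightarrow> L2_norm M (T f) \<le> L * L2_norm M f"
    using bounded_op_boundE[OF assms(2)] by metis
  note [simp] = bounded_op_L2[OF assms(1)] bounded_op_L2[OF assms(2)] L2_add L2_cmult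
  show ?thesis
  proof (rule bounded_opI[where K = "K * L"])
    show "S (T f) \<in> L2 M" if "f \<in> L2 M" for f
      using that by simp
  show "AE x in M. S (T (\<lambda>y. f y + g y)) x = S (T f) x + S (T g) x"
    if "f \<in> L2 M" "g \<in> L2 M" for f g
    using bounded_op_cong_AE[OF assms(1) _ _ bounded_op_add_AE[OF assms(2) that]]
      bounded_op_add_AE[OF assms(1), of "T f" "T g"] that by auto
  show "AE x in M. S (T (\<lambda>y. c * f y)) x = c * S (T f) x"
    if "f \<in> L2 M" for c f
    using bounded_op_cong_AE[OF assms(1) _ _ bounded_op_cmult_AE[OF assms(2) that, of c]]
      bounded_op_cmult_AE[OF assms(1), of "T f" c] that by auto
  show "L2_norm M (S (T f)) \<le> (K * L) * L2_norm M f" if "f \<in> L2 M" for f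
  proof -
    have "L2_norm M (S (T f)) \<le> K * L2_norm M (T f)" by (rule K(2)) (simp add: that)
    also have "\<dots> \<le> K * (L * L2_norm M f)" by (rule mult_left_mono[OF L(2)[OF that] K(1)])
    finally show ?thesis by simp
  qed
  qed
qed

lemma bounded_op_add:
  assumes "bounded_op M S" "bounded_op M T"
  shows "bounded_op M (\<lambda>f x. S f x + T f x)"
proof -
  obtain K where K: "\<And>f. f \<in> L2 M \<Longrightarrow> L2_norm M (S f) \<le> K * L2_norm M f"
    using bounded_op_boundE[OF assms(1)] by metis
  obtain L where L: "\<And>f. f \<in> L2 M \<Longrightarrow> L2_norm M (T f) \<le> L * L2_norm M f"
    using bounded_op_boundE[OF assms(2)] by metis
  note L2 = bounded_op_L2[OF assms(1)] bounded_op_L2[OF assms(2)]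
  show ?thesis
  proof (rule bounded_opI[where K = "K + L"])
    show "(\<lambda>x. S f x + T f x) \<in> L2 M" if "f \<in> L2 M" for f
      using that by (intro L2_add L2)
  show "AE x in M. S (\<lambda>y. f y + g y) x + T (\<lambda>y. f y + g y) x = S f x + T f x + (S g x + T g x)"
    if "f \<in> L2 M" "g \<in> L2 M" for f g
    using bounded_op_add_AE[OF assms(1) that] bounded_op_add_AE[OF assms(2) that] by auto
  show "AE x in M. S (\<lambda>y. c * f y) x + T (\<lambda>y. c * f y) x = c * (S f x + T f x)"
    if "f \<in> L2 M" for c f
    using bounded_op_cmult_AE[OF assms(1) that, of c] bounded_op_cmult_AE[OF assms(2) that, of c]
    by eventually_elim (simp add: distrib_left)
  show "L2_norm M (\<lambda>x. S f x + T f x) \<le> (K + L) * L2_norm M f" if "f \<in> L2 M" for f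
    using L2_norm_triangle[OF L2[OF that]] K[OF that] L[OF that] by (simp add: distrib_right)
  qed
qed

lemma bounded_op_cmult:
  assumes "bounded_op M T"
  shows "bounded_op M (\<lambda>f x. c * T f x)"
proof -
  obtain K where K: "\<And>f. f \<in> L2 M \<Longrightarrow> L2_norm M (T f) \<le> K * L2_norm M f"
    using bounded_op_boundE[OF assms(1)] by metis
  show ?thesis
  proof (rule bounded_opI[where K = "cmod c * K"])
    show "(\<lambda>x. c * T f x) \<in> L2 M" if "f \<in> L2 M" for f
      using that by (intro L2_cmult bounded_op_L2[OF assms])
  show "AE x in M. c * T (\<lambda>y. f y + g y) x = c * T f x + c * T g x"
    if "f \<in> L2 M" "g \<in> L2 M" for f g
    using bounded_op_add_AE[OF assms that] by eventually_elim (simp add: distrib_left)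
  show "AE x in M. c * T (\<lambda>y. d * f y) x = d * (c * T f x)"
    if "f \<in> L2 M" for d f
    using bounded_op_cmult_AE[OF assms that, of d] by eventually_elim simp
  show "L2_norm M (\<lambda>x. c * T f x) \<le> (cmod c * K) * L2_norm M f" if "f \<in> L2 M" for f
    using mult_left_mono[OF K[OF that], of "cmod c"] by (simp add: L2_norm_cmult mult.assoc)
  qed
qed

lemma bounded_op_diff:
  assumes "bounded_op M S" "bounded_op M T"
  shows "bounded_op M (\<lambda>f x. S f x - T f x)"
  using bounded_op_add[OF assms(1) bounded_op_cmult[OF assms(2), of "-1"]] by simp

lemma bounded_op_zero: "bounded_op M (\<lambda>f x. 0)"
  by (auto simp: bounded_op_def L2_zero intro!: exI[of _ 0])

lemma bounded_op_sum:
  assumes "\<And>n. n < N \<Longrightarrow> bounded_op M (T n)"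
  shows "bounded_op M (\<lambda>f x. \<Sum>n<(N::nat). T n f x)"
  using assms by (induction N) (auto simp: bounded_op_zero bounded_op_add)

lemma bounded_op_ident: "bounded_op M (\<lambda>f. f)"
  unfolding bounded_op_def by (auto intro!: exI[of _ 1])

lemma bounded_op_funpow:
  assumes "bounded_op M T"
  shows "bounded_op M (T ^^ n)"
proof (induction n)
  case 0
  show ?case using bounded_op_ident by (simp add: id_def)
next
  case (Suc n)
  then show ?case using bounded_op_compose[OF assms Suc.IH] by (simp add: comp_def)
qed

text \<open>
  \<^const>\<open>op_norm\<close> is a supremum of reals, meaningful only for a set that is bounded above. The
  bound from boundedness provides this, and homogeneity extends the estimate beyond the unit ball.
\<close>

lemma L2_norm_le_op_norm:
  assumes "bounded_op M T" "f \<in> L2 M"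
  shows "L2_norm M (T f) \<le> op_norm M T * L2_norm M f"
proof (cases "L2_norm M f = 0")
  case True
  obtain K where "L2_norm M (T f) \<le> K * L2_norm M f"
    using bounded_op_boundE[OF assms(1)] assms(2) by metis
  with True show ?thesis by simp
next
  case False
  define r where "r = L2_norm M f"
  have r: "r > 0" using False L2_norm_nonneg[of M f] unfolding r_def by linarith
  obtain K where K: "K \<ge> 0" "\<And>f. f \<in> L2 M \<Longrightarrow> L2_norm M (T f) \<le> K * L2_norm M f"
    using bounded_op_boundE[OF assms(1)] by metis
  let ?B = "{f \<in> L2 M. L2_norm M f \<le> 1}"
  let ?g = "\<lambda>x. complex_of_real (1 / r) * f x"
  have g: "?g \<in> L2 M" using assms by (intro L2_cmult)
  have "L2_norm M ?g = 1"
    unfolding L2_norm_cmult using r by (simp add: r_def[symmetric] norm_divide)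
  have bdd: "bdd_above ((\<lambda>f. L2_norm M (T f)) ` ?B)"
  proof (rule bdd_aboveI2)
    fix h assume "h \<in> ?B"
    then have "L2_norm M (T h) \<le> K * L2_norm M h" "L2_norm M h \<le> 1" using K by auto
    then show "L2_norm M (T h) \<le> K" using K(1) mult_left_le[of "L2_norm M h" K] by linarith
  qed
  have "L2_norm M (T ?g) = L2_norm M (\<lambda>x. complex_of_real (1 / r) * T f x)"
    by (rule L2_norm_cong_AE[OF bounded_op_L2[OF assms(1) g] L2_cmult[OF bounded_op_L2[OF assms]]
          bounded_op_cmult_AE[OF assms]])
  also have "\<dots> = L2_norm M (T f) / r"
    unfolding L2_norm_cmult using r by (simp add: norm_divide)
  finally have "L2_norm M (T f) / r \<le> op_norm M T"
    unfolding op_norm_def using cSUP_upper[OF _ bdd, of ?g] g \<open>L2_norm M ?g = 1\<close> by simp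
  then show ?thesis using r by (simp add: r_def[symmetric] field_simps)
qed

text \<open>
  Polarization: the form \<open>\<langle>R h, h\<rangle>\<close> is real at \<open>h = f + c g\<close>. Taking \<open>c = 1\<close> and \<open>c = \<i>\<close>
  identifies the imaginary and the real part of \<open>\<langle>R f, g\<rangle>\<close> with those of \<open>\<langle>f, R g\<rangle>\<close>.
\<close>

lemma positive_op_selfadjoint:
  assumes "positive_op M R" "f \<in> L2 M" "g \<in> L2 M"
  shows "L2_inner M (R f) g = L2_inner M f (R g)"
proof -
  have R: "bounded_op M R" using assms by (simp add: positive_op_def)
  note L2 = bounded_op_L2[OF R] L2_add L2_cmult assms
  have real: "Im (L2_inner M (R h) h) = 0" if "h \<in> L2 M" for h
    using assms(1) that by (auto simp: positive_op_def less_eq_complex_def)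
  \<comment> \<open>\<open>R\<close> is additive only almost everywhere, hence the detour through the integrand.\<close>
  have expand: "L2_inner M (R (\<lambda>x. f x + c * g x)) (\<lambda>x. f x + c * g x)
    = L2_inner M (R f) f + cnj c * L2_inner M (R f) g
      + (c * L2_inner M (R g) f + c * cnj c * L2_inner M (R g) g)" for c
  proof -
    let ?h = "\<lambda>x. f x + c * g x"
    have "AE x in M. R ?h x = R f x + c * R g x"
      using bounded_op_add_AE[OF R assms(2) L2_cmult[OF assms(3), of c]]
        bounded_op_cmult_AE[OF R assms(3), of c] by auto
    then have "AE x in M. R ?h x * cnj (?h x) = (R f x + c * R g x) * cnj (?h x)"
      by auto
    then have "L2_inner M (R ?h) ?h = L2_inner M (\<lambda>x. R f x + c * R g x) ?h"
      unfolding L2_inner_def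
      by (intro integral_cong_AE L2_measurable borel_measurable_integrable[OF L2_mult_integrable] L2)
    also have "\<dots> = L2_inner M (R f) f + cnj c * L2_inner M (R f) g
      + (c * L2_inner M (R g) f + c * cnj c * L2_inner M (R g) g)"
      by (simp add: L2_inner_add_left L2_inner_add_right L2_inner_cmult_left L2_inner_cmult_right
          L2 algebra_simps)
    finally show ?thesis .
  qed
  let ?a = "L2_inner M (R f) g" and ?b = "L2_inner M (R g) f"
  have "Im (L2_inner M (R (\<lambda>x. f x + c * g x)) (\<lambda>x. f x + c * g x)) = 0" for c
    by (rule real) (intro L2)
  from this[of 1] this[of \<i>] have "Im ?a + Im ?b = 0" "Re ?b - Re ?a = 0"
    using real[of f] real[of g] assms unfolding expand by auto
  then have "?a = cnj ?b" by (simp add: complex_eq_iff)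
  then show ?thesis by (simp add: L2_inner_commute[of M f "R g"])
qed

section \<open>Operators in the class of a bounded operator vanish on its kernel\<close>

lemma is_adjoint_funpow_inner:
  assumes "bounded_op M T" "is_adjoint M T T'" "f \<in> L2 M" "g \<in> L2 M"
  shows "L2_inner M ((T ^^ n) f) g = L2_inner M f ((T' ^^ n) g)"
  using assms(4)
proof (induction n arbitrary: g)
  case 0
  show ?case by simp
next
  case (Suc n)
  have T': "bounded_op M T'" using assms by (simp add: is_adjoint_def)
  have "L2_inner M ((T ^^ Suc n) f) g = L2_inner M ((T ^^ n) f) (T' g)"
    using assms(2) bounded_op_L2[OF bounded_op_funpow[OF assms(1)] assms(3)] Suc.prems
    by (simp add: is_adjoint_def)
  also have "\<dots> = L2_inner M f ((T' ^^ Suc n) g)"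
    using Suc bounded_op_L2[OF T'] by (simp add: funpow_swap1)
  finally show ?case .
qed

text \<open>
  Since \<open>R\<close> is self-adjoint, \<open>\<parallel>R f\<parallel>\<^sup>2 = \<langle>f, R\<^sup>2 f\<rangle>\<close>; inserting the series for \<open>R\<^sup>2\<close> turns the
  \<open>n\<close>-th term into \<open>d\<^sub>m\<^sup>2\<^sup>n \<parallel>T\<^sup>n f\<parallel>\<^sup>2\<close>. Operator norm convergence of the series gives convergence
  of these numbers through the Cauchy-Schwarz inequality.
\<close>

lemma is_R_norm_sums:
  assumes T: "bounded_op M T" and R: "is_R M T m R" and f: "f \<in> L2 M"
  shows "(\<lambda>n. d_coeff M T m ^ (2 * n) * (L2_norm M ((T ^^ n) f))\<^sup>2) sums (L2_norm M (R f))\<^sup>2"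
proof -
  let ?c = "\<lambda>n. d_coeff M T m ^ (2 * n)"
  have pos: "positive_op M R" and bR: "bounded_op M R"
    using R by (auto simp: is_R_def positive_op_def)
  obtain T' where T': "is_adjoint M T T'" and lim: "(\<lambda>N. op_norm M (\<lambda>f x. R (R f) x -
          (\<Sum>n<N. of_real (?c n) * (T' ^^ n) ((T ^^ n) f) x))) \<longlonglongrightarrow> 0"
    using R by (auto simp: is_R_def)
  have bT': "bounded_op M T'" using T' by (simp add: is_adjoint_def)
  define P where "P = (\<lambda>n f x. complex_of_real (?c n) * (T' ^^ n) ((T ^^ n) f) x)"
  define D where "D = (\<lambda>N f x. R (R f) x - (\<Sum>n<N. P n f x))"
  have bP: "bounded_op M (P n)" for n
    unfolding P_def
    by (intro bounded_op_cmult bounded_op_compose[OF bounded_op_funpow bounded_op_funpow] T bT')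
  have bD: "bounded_op M (D N)" for N
    unfolding D_def by (intro bounded_op_diff bounded_op_sum bP bounded_op_compose[OF bR bR])
  have "L2_inner M f (P n f) = complex_of_real (?c n * (L2_norm M ((T ^^ n) f))\<^sup>2)" for n
    unfolding P_def L2_inner_cmult_right
    using is_adjoint_funpow_inner[OF T T' f bounded_op_L2[OF bounded_op_funpow[OF T] f], of n n]
    by (simp add: L2_inner_self)
  moreover have "L2_inner M f (R (R f)) = complex_of_real ((L2_norm M (R f))\<^sup>2)"
    using positive_op_selfadjoint[OF pos f bounded_op_L2[OF bR f]] by (simp add: L2_inner_self)
  ultimately have inner: "L2_inner M f (D N f) = complex_of_real ((L2_norm M (R f))\<^sup>2
      - (\<Sum>n<N. ?c n * (L2_norm M ((T ^^ n) f))\<^sup>2))" for N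
    unfolding D_def using f bP bR
    by (simp add: L2_inner_diff_right L2_inner_sum_right L2_sum bounded_op_L2)
  have bound: "\<bar>(\<Sum>n<N. ?c n * (L2_norm M ((T ^^ n) f))\<^sup>2) - (L2_norm M (R f))\<^sup>2\<bar>
      \<le> op_norm M (D N) * (L2_norm M f)\<^sup>2" for N
  proof -
    have "\<bar>(\<Sum>n<N. ?c n * (L2_norm M ((T ^^ n) f))\<^sup>2) - (L2_norm M (R f))\<^sup>2\<bar>
        = cmod (L2_inner M f (D N f))"
      unfolding inner norm_of_real by (rule abs_minus_commute)
    also have "\<dots> \<le> L2_norm M f * L2_norm M (D N f)"
      by (rule L2_Cauchy_Schwarz[OF f bounded_op_L2[OF bD f]])
    also have "\<dots> \<le> L2_norm M f * (op_norm M (D N) * L2_norm M f)"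
      by (intro mult_left_mono L2_norm_le_op_norm bD f) simp
    finally show ?thesis by (simp add: power2_eq_square mult_ac)
  qed
  have "(\<lambda>N. op_norm M (D N) * (L2_norm M f)\<^sup>2) \<longlonglongrightarrow> 0"
    using lim unfolding D_def P_def by (rule tendsto_mult_left_zero)
  then have "(\<lambda>N. (\<Sum>n<N. ?c n * (L2_norm M ((T ^^ n) f))\<^sup>2) - (L2_norm M (R f))\<^sup>2) \<longlonglongrightarrow> 0"
    by (rule Lim_null_comparison[rotated]) (simp add: bound always_eventually)
  then show ?thesis
    unfolding sums_def by (simp add: LIM_zero_iff)
qed

text \<open>
  Keep only the term \<open>n = 0\<close> of the series, whose terms are nonnegative because only even powers
  of \<open>d\<^sub>m\<close> occur.
\<close>

lemma is_R_norm_ge: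
  assumes "bounded_op M T" "is_R M T m R" "f \<in> L2 M"
  shows "L2_norm M f \<le> L2_norm M (R f)"
proof (rule power2_le_imp_le)
  let ?s = "\<lambda>n. d_coeff M T m ^ (2 * n) * (L2_norm M ((T ^^ n) f))\<^sup>2"
  have "sum ?s {..<1} \<le> suminf ?s"
    using is_R_norm_sums[OF assms] by (intro sum_le_suminf) (auto simp: sums_iff power_mult)
  then show "(L2_norm M f)\<^sup>2 \<le> (L2_norm M (R f))\<^sup>2"
    using is_R_norm_sums[OF assms] by (simp add: sums_iff)
qed simp

text \<open>
  For \<open>f\<close> in the kernel of \<open>T\<close> the term \<open>n = 0\<close> is the only nonzero one. The value does not
  depend on \<open>m\<close>, which makes the limit \<open>m \<rightarrow> \<infinity>\<close> in the next lemma effective.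
\<close>

lemma is_R_norm_kernel:
  assumes T: "bounded_op M T" and "is_R M T m R" and f: "f \<in> L2 M" and "AE x in M. T f x = 0"
  shows "L2_norm M (R f) = L2_norm M f"
proof -
  let ?s = "\<lambda>n. d_coeff M T m ^ (2 * n) * (L2_norm M ((T ^^ n) f))\<^sup>2"
  have "?s n = 0" if "n \<noteq> 0" for n
  proof -
    from that obtain k where n: "n = Suc k" by (cases n) auto
    have "AE x in M. (T ^^ k) (T f) x = 0"
      by (intro bounded_op_eq_0_AE[OF bounded_op_funpow[OF T]] bounded_op_L2[OF T f] assms)
    then have "L2_norm M ((T ^^ n) f) = 0"
      unfolding n funpow_Suc_right comp_def
      by (subst L2_norm_eq_0_iff_AE) (intro bounded_op_L2[OF bounded_op_funpow[OF T]] bounded_op_L2[OF T f])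
    then show ?thesis by simp
  qed
  then have "?s sums (\<Sum>n\<in>{0}. ?s n)"
    by (intro sums_finite) auto
  with is_R_norm_sums[OF assms(1-3)] have "(L2_norm M (R f))\<^sup>2 = (\<Sum>n\<in>{0}. ?s n)"
    by (rule sums_unique2)
  then show ?thesis by simp
qed

text \<open>
  For \<open>T f = 0\<close> the two norm estimates for \<open>R\<^sub>m\<close> give
  \<open>\<parallel>S f\<parallel> \<le> \<parallel>R\<^sub>m S f\<parallel> \<le> \<parallel>R\<^sub>m S R\<^sub>m\<inverse>\<parallel> \<parallel>R\<^sub>m f\<parallel> = \<parallel>R\<^sub>m S R\<^sub>m\<inverse>\<parallel> \<parallel>f\<parallel>\<close>,
  and the right-hand side tends to \<open>0\<close>.
\<close>

lemma Q_class_kernel: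
  assumes T: "bounded_op M T" and S: "S \<in> Q_class M T" and f: "f \<in> L2 M"
    and Tf: "AE x in M. T f x = 0"
  shows "AE x in M. S f x = 0"
proof -
  obtain R R' where R: "\<And>m. m \<ge> 1 \<Longrightarrow> is_R M T m (R m)"
    and R': "\<And>m. m \<ge> 1 \<Longrightarrow> is_inverse M (R m) (R' m)"
    and lim: "(\<lambda>m. op_norm M (\<lambda>f. R m (S (R' m f)))) \<longlonglongrightarrow> 0"
    using S by (auto simp: Q_class_def)
  have bS: "bounded_op M S" using S by (simp add: Q_class_def)
  have bound: "L2_norm M (S f) \<le> op_norm M (\<lambda>f. R m (S (R' m f))) * L2_norm M f" if "m \<ge> 1" for m
  proof -
    have bR: "bounded_op M (R m)" using R[OF that] by (simp add: is_R_def positive_op_def)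
    have bR': "bounded_op M (R' m)" using R'[OF that] by (simp add: is_inverse_def)
    note bRR' = bounded_op_compose[OF bR bounded_op_compose[OF bS bR']]
    have Rf: "R m f \<in> L2 M" using bounded_op_L2[OF bR f] .
    have inv: "AE x in M. R' m (R m f) x = f x" using R'[OF that] f by (auto simp: is_inverse_def)
    have "L2_norm M (S f) = L2_norm M (S (R' m (R m f)))"
      by (intro L2_norm_cong_AE[symmetric] bounded_op_cong_AE[OF bS _ f inv]
          bounded_op_L2[OF bS] bounded_op_L2[OF bR'] Rf f)
    also have "\<dots> \<le> L2_norm M (R m (S (R' m (R m f))))"
      by (intro is_R_norm_ge[OF T R[OF that]] bounded_op_L2[OF bS] bounded_op_L2[OF bR'] Rf)
    also have "\<dots> \<le> op_norm M (\<lambda>f. R m (S (R' m f))) * L2_norm M (R m f)"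
      by (rule L2_norm_le_op_norm[OF bRR' Rf])
    finally show ?thesis unfolding is_R_norm_kernel[OF T R[OF that] f Tf] .
  qed
  have "(\<lambda>m. op_norm M (\<lambda>f. R m (S (R' m f))) * L2_norm M f) \<longlonglongrightarrow> 0"
    using lim by (rule tendsto_mult_left_zero)
  then have "L2_norm M (S f) \<le> 0"
    by (rule tendsto_lowerbound) (use bound in \<open>auto simp: eventually_sequentially\<close>)
  then have "L2_norm M (S f) = 0" using L2_norm_nonneg[of M "S f"] by linarith
  then show ?thesis using L2_norm_eq_0_iff_AE[OF bounded_op_L2[OF bS f]] by simp
qed

section \<open>Conditional expectation without integrability\<close>

context sigma_finite_subalgebra
begin

text \<open>
  The conditional expectation of a real function may be computed from any decomposition into a
  difference of nonnegative functions with finite conditional expectation, not only from the positive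
  and negative parts. The identity \<open>f\<^sup>+ + q = f\<^sup>- + p\<close> encodes \<open>f = p - q\<close> without a subtraction
  in \<^typ>\<open>ennreal\<close>. Additivity and the pull-out rule below are instances. They are needed under
  almost everywhere finiteness of the conditional expectation, because on an infinite measure space
  neither \<open>u\<close> nor a product \<open>u f\<close> has to be integrable.
\<close>

lemma real_cond_exp_eq_diff:
  assumes [measurable]: "f \<in> borel_measurable M" "p \<in> borel_measurable M" "q \<in> borel_measurable M"
    and le: "\<And>x. ennreal (f x) \<le> p x" "\<And>x. ennreal (- f x) \<le> q x"
    and eq: "\<And>x. ennreal (f x) + q x = ennreal (- f x) + p x"
    and fin: "AE x in M. nn_cond_exp M F p x < \<infinity>" "AE x in M. nn_cond_exp M F q x < \<infinity>"
  shows "AE x in M. real_cond_exp M F f x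
    = enn2real (nn_cond_exp M F p x) - enn2real (nn_cond_exp M F q x)"
proof -
  let ?fp = "\<lambda>x. ennreal (f x)" and ?fm = "\<lambda>x. ennreal (- f x)"
  have 1: "AE x in M. nn_cond_exp M F ?fp x + nn_cond_exp M F q x = nn_cond_exp M F (\<lambda>x. ?fp x + q x) x"
    by (rule nn_cond_exp_sum) measurable
  have 2: "AE x in M. nn_cond_exp M F ?fm x + nn_cond_exp M F p x = nn_cond_exp M F (\<lambda>x. ?fm x + p x) x"
    by (rule nn_cond_exp_sum) measurable
  have 3: "AE x in M. nn_cond_exp M F ?fp x \<le> nn_cond_exp M F p x"
    by (rule nn_cond_exp_mono) (use le in auto)
  have 4: "AE x in M. nn_cond_exp M F ?fm x \<le> nn_cond_exp M F q x"
    by (rule nn_cond_exp_mono) (use le in auto)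
  show ?thesis
    using 1 2 3 4 fin
  proof eventually_elim
    case (elim x)
    have sum: "nn_cond_exp M F ?fp x + nn_cond_exp M F q x
        = nn_cond_exp M F ?fm x + nn_cond_exp M F p x"
      using elim(1,2) by (simp add: eq)
    have fin: "nn_cond_exp M F ?fp x < \<infinity>" "nn_cond_exp M F ?fm x < \<infinity>"
      using elim by (auto intro: le_less_trans)
    have "enn2real (nn_cond_exp M F ?fp x) + enn2real (nn_cond_exp M F q x)
        = enn2real (nn_cond_exp M F ?fm x) + enn2real (nn_cond_exp M F p x)"
      using arg_cong[OF sum, of enn2real] fin elim(5,6) by (simp add: enn2real_plus)
    then show ?case unfolding real_cond_exp_def by simp
  qed
qed

lemma nn_cond_exp_finite_parts:
  assumes [measurable]: "f \<in> borel_measurable M"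
    and "AE x in M. nn_cond_exp M F (\<lambda>x. ennreal \<bar>f x\<bar>) x < \<infinity>"
  shows "AE x in M. nn_cond_exp M F (\<lambda>x. ennreal (f x)) x < \<infinity>"
    and "AE x in M. nn_cond_exp M F (\<lambda>x. ennreal (- f x)) x < \<infinity>"
proof -
  have "AE x in M. nn_cond_exp M F (\<lambda>x. ennreal (f x)) x \<le> nn_cond_exp M F (\<lambda>x. ennreal \<bar>f x\<bar>) x"
    by (rule nn_cond_exp_mono) (auto intro: ennreal_leI)
  then show "AE x in M. nn_cond_exp M F (\<lambda>x. ennreal (f x)) x < \<infinity>"
    using assms(2) by eventually_elim (rule le_less_trans)
  have "AE x in M. nn_cond_exp M F (\<lambda>x. ennreal (- f x)) x \<le> nn_cond_exp M F (\<lambda>x. ennreal \<bar>f x\<bar>) x"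
    by (rule nn_cond_exp_mono) (auto intro: ennreal_leI)
  then show "AE x in M. nn_cond_exp M F (\<lambda>x. ennreal (- f x)) x < \<infinity>"
    using assms(2) by eventually_elim (rule le_less_trans)
qed

lemma real_cond_exp_add_finite:
  assumes [measurable]: "f \<in> borel_measurable M" "g \<in> borel_measurable M"
    and f: "AE x in M. nn_cond_exp M F (\<lambda>x. ennreal \<bar>f x\<bar>) x < \<infinity>"
    and g: "AE x in M. nn_cond_exp M F (\<lambda>x. ennreal \<bar>g x\<bar>) x < \<infinity>"
  shows "AE x in M. real_cond_exp M F (\<lambda>x. f x + g x) x = real_cond_exp M F f x + real_cond_exp M F g x"
proof -
  note fin = nn_cond_exp_finite_parts[OF assms(1) f] nn_cond_exp_finite_parts[OF assms(2) g]
  let ?p = "\<lambda>x. ennreal (f x) + ennreal (g x)" and ?q = "\<lambda>x. ennreal (- f x) + ennreal (- g x)"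
  have p: "AE x in M. nn_cond_exp M F (\<lambda>x. ennreal (f x)) x + nn_cond_exp M F (\<lambda>x. ennreal (g x)) x
      = nn_cond_exp M F ?p x"
    by (rule nn_cond_exp_sum) measurable
  have q: "AE x in M. nn_cond_exp M F (\<lambda>x. ennreal (- f x)) x + nn_cond_exp M F (\<lambda>x. ennreal (- g x)) x
      = nn_cond_exp M F ?q x"
    by (rule nn_cond_exp_sum) measurable
  have *: "ennreal (a + b) \<le> ennreal a + ennreal b" for a b :: real
    by (metis ennreal_leI ennreal_plus max.cobounded2 max_0L add_mono ennreal_max_0 max.cobounded1)
  have "AE x in M. real_cond_exp M F (\<lambda>x. f x + g x) x
      = enn2real (nn_cond_exp M F ?p x) - enn2real (nn_cond_exp M F ?q x)"
  proof (rule real_cond_exp_eq_diff)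
    show "AE x in M. nn_cond_exp M F ?p x < \<infinity>"
      using p fin(1,3)
    proof eventually_elim
      case (elim x)
      then show ?case unfolding elim(1)[symmetric] by simp
    qed
    show "AE x in M. nn_cond_exp M F ?q x < \<infinity>"
      using q fin(2,4)
    proof eventually_elim
      case (elim x)
      then show ?case unfolding elim(1)[symmetric] by simp
    qed
    show "ennreal (f x + g x) \<le> ?p x" "ennreal (- (f x + g x)) \<le> ?q x" for x
      using *[of "f x" "g x"] *[of "- f x" "- g x"] by simp_all
    \<comment> \<open>With all arguments nonnegative, the identity becomes one between real numbers.\<close>
    have pos: "ennreal t = ennreal (max 0 t)" for t by (simp add: max_def ennreal_neg)
    show "ennreal (f x + g x) + ?q x = ennreal (- (f x + g x)) + ?p x" for x
      unfolding pos[of "f x"] pos[of "g x"] pos[of "- f x"] pos[of "- g x"]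
        pos[of "f x + g x"] pos[of "- (f x + g x)"]
      by (simp add: ennreal_plus[symmetric] del: ennreal_plus ennreal_max_0 ennreal_max_0')
  qed measurable
  then show ?thesis
    using p q fin
  proof eventually_elim
    case (elim x)
    show ?case
      unfolding elim(1) elim(2)[symmetric] elim(3)[symmetric]
      using elim(4-7) by (simp add: real_cond_exp_def enn2real_plus)
  qed
qed

text \<open>
  For \<open>a \<ge> 0\<close> this is the rule for nonnegative functions. A factor of either sign is split as
  \<open>a f = (a\<^sup>+ f\<^sup>+ + a\<^sup>- f\<^sup>-) - (a\<^sup>+ f\<^sup>- + a\<^sup>- f\<^sup>+)\<close>.
\<close>

lemma real_cond_exp_mult_finite:
  assumes a [measurable]: "a \<in> borel_measurable F" and [measurable]: "f \<in> borel_measurable M"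
    and f: "AE x in M. nn_cond_exp M F (\<lambda>x. ennreal \<bar>f x\<bar>) x < \<infinity>"
  shows "AE x in M. real_cond_exp M F (\<lambda>x. a x * f x) x = a x * real_cond_exp M F f x"
proof -
  have [measurable]: "a \<in> borel_measurable M"
    using subalg a by (rule measurable_from_subalg)
  note fin = nn_cond_exp_finite_parts[OF assms(2) f]
  let ?fp = "\<lambda>x. ennreal (f x)" and ?fm = "\<lambda>x. ennreal (- f x)"
  let ?p = "\<lambda>x. ennreal (a x) * ?fp x + ennreal (- a x) * ?fm x"
  let ?q = "\<lambda>x. ennreal (a x) * ?fm x + ennreal (- a x) * ?fp x"
  have prod: "AE x in M. ennreal (a x) * nn_cond_exp M F h x = nn_cond_exp M F (\<lambda>x. ennreal (a x) * h x) x"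
    "AE x in M. ennreal (- a x) * nn_cond_exp M F h x = nn_cond_exp M F (\<lambda>x. ennreal (- a x) * h x) x"
    if "h \<in> borel_measurable M" for h
    by (intro nn_cond_exp_prod that; measurable)+
  have p0: "AE x in M. nn_cond_exp M F (\<lambda>x. ennreal (a x) * ?fp x) x
      + nn_cond_exp M F (\<lambda>x. ennreal (- a x) * ?fm x) x = nn_cond_exp M F ?p x"
    by (rule nn_cond_exp_sum) measurable
  have p: "AE x in M. nn_cond_exp M F ?p x
      = ennreal (a x) * nn_cond_exp M F ?fp x + ennreal (- a x) * nn_cond_exp M F ?fm x"
    using p0 prod(1)[of ?fp] prod(2)[of ?fm] by auto
  have q0: "AE x in M. nn_cond_exp M F (\<lambda>x. ennreal (a x) * ?fm x) x
      + nn_cond_exp M F (\<lambda>x. ennreal (- a x) * ?fp x) x = nn_cond_exp M F ?q x"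
    by (rule nn_cond_exp_sum) measurable
  have q: "AE x in M. nn_cond_exp M F ?q x
      = ennreal (a x) * nn_cond_exp M F ?fm x + ennreal (- a x) * nn_cond_exp M F ?fp x"
    using q0 prod(1)[of ?fm] prod(2)[of ?fp] by auto
  have "AE x in M. real_cond_exp M F (\<lambda>x. a x * f x) x
      = enn2real (nn_cond_exp M F ?p x) - enn2real (nn_cond_exp M F ?q x)"
  proof (rule real_cond_exp_eq_diff)
    show "AE x in M. nn_cond_exp M F ?p x < \<infinity>"
      using p fin by eventually_elim (simp add: ennreal_mult_less_top)
    show "AE x in M. nn_cond_exp M F ?q x < \<infinity>"
      using q fin by eventually_elim (simp add: ennreal_mult_less_top)
    fix x
    have parts: "ennreal (a x * f x) = ?p x \<and> ennreal (- (a x * f x)) = ?q x"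
    proof (cases "0 \<le> a x")
      case True
      then show ?thesis
        using ennreal_mult'[OF True, of "f x"] ennreal_mult'[OF True, of "- f x"] by (simp add: ennreal_neg)
    next
      case False
      then have "0 \<le> - a x" by simp
      from ennreal_mult'[OF this, of "f x"] ennreal_mult'[OF this, of "- f x"] False
      show ?thesis by (simp add: ennreal_neg)
    qed
    show "ennreal (a x * f x) \<le> ?p x" "ennreal (- (a x * f x)) \<le> ?q x"
      "ennreal (a x * f x) + ?q x = ennreal (- (a x * f x)) + ?p x"
      using parts by (simp_all add: add.commute)
  qed measurable
  then show ?thesis
    using p q fin
  proof eventually_elim
    case (elim x)
    have [simp]: "enn2real (ennreal r * s) = max 0 r * enn2real s" for r s
      by (simp add: enn2real_mult max_def ennreal_neg)
    have "max 0 (a x) - max 0 (- a x) = a x" by simp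
    then show ?case
      unfolding elim(1) elim(2) elim(3) using elim(4,5)
      by (simp add: real_cond_exp_def enn2real_plus ennreal_mult_less_top max_def algebra_simps)
  qed
qed

text \<open>
  For nonnegative \<open>a\<close> measurable with respect to the subalgebra, taking conditional expectations in
  \<open>2 C a v h \<le> a\<^sup>2 v\<^sup>2 + C\<^sup>2 h\<^sup>2\<close> gives \<open>2 C a E(v h) \<le> C a\<^sup>2 + C\<^sup>2 E(h\<^sup>2)\<close>. The choice \<open>a = 1\<close> shows
  that \<open>E(v h)\<close> is finite; then \<open>a = E(v h)\<close> is admissible and gives the estimate.
\<close>

lemma nn_cond_exp_Cauchy_Schwarz:
  assumes [measurable]: "v \<in> borel_measurable M" "h \<in> borel_measurable M"
    and nonneg: "\<And>x. 0 \<le> v x" "\<And>x. 0 \<le> h x" and C: "0 < C"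
    and v: "AE x in M. nn_cond_exp M F (\<lambda>x. ennreal ((v x)\<^sup>2)) x \<le> ennreal C"
    and h: "AE x in M. nn_cond_exp M F (\<lambda>x. ennreal ((h x)\<^sup>2)) x < \<infinity>"
  shows "AE x in M. nn_cond_exp M F (\<lambda>x. ennreal (v x * h x)) x < \<infinity>"
    and "AE x in M. (enn2real (nn_cond_exp M F (\<lambda>x. ennreal (v x * h x)) x))\<^sup>2
      \<le> C * enn2real (nn_cond_exp M F (\<lambda>x. ennreal ((h x)\<^sup>2)) x)"
proof -
  let ?vh = "\<lambda>x. ennreal (v x * h x)" and ?v2 = "\<lambda>x. ennreal ((v x)\<^sup>2)" and ?h2 = "\<lambda>x. ennreal ((h x)\<^sup>2)"
  have young: "AE x in M. ennreal (2 * C * a x) * nn_cond_exp M F ?vh x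
      \<le> ennreal ((a x)\<^sup>2) * nn_cond_exp M F ?v2 x + ennreal (C\<^sup>2) * nn_cond_exp M F ?h2 x"
    if a: "a \<in> borel_measurable F" "\<And>x. 0 \<le> a x" for a
  proof -
    note [measurable] = a(1)
    have [measurable]: "a \<in> borel_measurable M"
      using subalg a(1) by (rule measurable_from_subalg)
    have 1: "AE x in M. ennreal (2 * C * a x) * nn_cond_exp M F ?vh x
        = nn_cond_exp M F (\<lambda>x. ennreal (2 * C * a x) * ?vh x) x"
      by (rule nn_cond_exp_prod) measurable
    have 2: "AE x in M. nn_cond_exp M F (\<lambda>x. ennreal (2 * C * a x) * ?vh x) x
        \<le> nn_cond_exp M F (\<lambda>x. ennreal ((a x)\<^sup>2) * ?v2 x + ennreal (C\<^sup>2) * ?h2 x) x"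
    proof (rule nn_cond_exp_mono)
      show "AE x in M. ennreal (2 * C * a x) * ?vh x \<le> ennreal ((a x)\<^sup>2) * ?v2 x + ennreal (C\<^sup>2) * ?h2 x"
      proof (intro AE_I2)
        fix x
        have "2 * C * a x * (v x * h x) \<le> (a x)\<^sup>2 * (v x)\<^sup>2 + C\<^sup>2 * (h x)\<^sup>2"
          using sum_squares_bound[of "a x * v x" "C * h x"] by (simp add: power_mult_distrib mult_ac)
        then show "ennreal (2 * C * a x) * ?vh x \<le> ennreal ((a x)\<^sup>2) * ?v2 x + ennreal (C\<^sup>2) * ?h2 x"
          using nonneg a(2) C
          by (simp add: ennreal_mult''[symmetric] ennreal_plus[symmetric] ennreal_leI del: ennreal_plus)
      qed
    qed measurable
    have 3: "AE x in M. nn_cond_exp M F (\<lambda>x. ennreal ((a x)\<^sup>2) * ?v2 x) x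
        + nn_cond_exp M F (\<lambda>x. ennreal (C\<^sup>2) * ?h2 x) x
        = nn_cond_exp M F (\<lambda>x. ennreal ((a x)\<^sup>2) * ?v2 x + ennreal (C\<^sup>2) * ?h2 x) x"
      by (rule nn_cond_exp_sum) measurable
    have 4: "AE x in M. ennreal ((a x)\<^sup>2) * nn_cond_exp M F ?v2 x
        = nn_cond_exp M F (\<lambda>x. ennreal ((a x)\<^sup>2) * ?v2 x) x"
      by (rule nn_cond_exp_prod) measurable
    have 5: "AE x in M. ennreal (C\<^sup>2) * nn_cond_exp M F ?h2 x
        = nn_cond_exp M F (\<lambda>x. ennreal (C\<^sup>2) * ?h2 x) x"
      by (rule nn_cond_exp_prod) measurable
    show ?thesis using 1 2 3 4 5 by eventually_elim simp
  qed
  show fin: "AE x in M. nn_cond_exp M F ?vh x < \<infinity>"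
    using young[OF borel_measurable_const zero_le_one] v h
  proof eventually_elim
    case (elim x)
    have "ennreal (2 * C) * nn_cond_exp M F ?vh x < \<infinity>"
    proof (rule le_less_trans)
      show "ennreal (2 * C) * nn_cond_exp M F ?vh x
          \<le> nn_cond_exp M F ?v2 x + ennreal (C\<^sup>2) * nn_cond_exp M F ?h2 x"
        using elim(1) by simp
      show "nn_cond_exp M F ?v2 x + ennreal (C\<^sup>2) * nn_cond_exp M F ?h2 x < \<infinity>"
        using elim(2,3) by (auto simp: ennreal_mult_less_top intro: le_less_trans)
    qed
    then show ?case using C by (auto simp: ennreal_mult_less_top)
  qed
  let ?a = "\<lambda>x. enn2real (nn_cond_exp M F ?vh x)"
  have young_a: "AE x in M. ennreal (2 * C * ?a x) * nn_cond_exp M F ?vh x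
      \<le> ennreal ((?a x)\<^sup>2) * nn_cond_exp M F ?v2 x + ennreal (C\<^sup>2) * nn_cond_exp M F ?h2 x"
    by (rule young) simp_all
  show "AE x in M. (?a x)\<^sup>2 \<le> C * enn2real (nn_cond_exp M F ?h2 x)"
    using young_a v h fin
  proof eventually_elim
    case (elim x)
    define a where "a = ?a x"
    define H where "H = enn2real (nn_cond_exp M F ?h2 x)"
    have vh: "nn_cond_exp M F ?vh x = ennreal a" and h2: "nn_cond_exp M F ?h2 x = ennreal H"
      using elim by (simp_all add: a_def H_def)
    have nn: "0 \<le> a" "0 \<le> H" by (simp_all add: a_def H_def)
    have "ennreal (2 * C * a) * ennreal a
        \<le> ennreal (a\<^sup>2) * nn_cond_exp M F ?v2 x + ennreal (C\<^sup>2) * ennreal H"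
      using elim(1) nn unfolding vh h2 by simp
    also have "\<dots> \<le> ennreal (a\<^sup>2) * ennreal C + ennreal (C\<^sup>2) * ennreal H"
      by (intro add_right_mono mult_left_mono elim(2)) simp
    finally have "2 * C * a * a \<le> a\<^sup>2 * C + C\<^sup>2 * H"
      using nn C by (simp add: ennreal_mult''[symmetric] ennreal_plus[symmetric] del: ennreal_plus)
    then have "C * a\<^sup>2 \<le> C * (C * H)" by (simp add: power2_eq_square algebra_simps)
    then show ?case using C unfolding a_def[symmetric] H_def[symmetric] by simp
  qed
qed


text \<open>
  The nonnegative conditional expectation preserves the integral; a finite integral forces it to be
  finite almost everywhere.
\<close>

lemma integrable_enn2real_nn_cond_exp:
  assumes g: "integrable M g" and nonneg: "\<And>x. 0 \<le> g x"
  shows "AE x in M. nn_cond_exp M F (\<lambda>x. ennreal (g x)) x < \<infinity>"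
    and "integrable M (\<lambda>x. enn2real (nn_cond_exp M F (\<lambda>x. ennreal (g x)) x))"
proof -
  note [measurable] = borel_measurable_integrable[OF g]
  let ?E = "nn_cond_exp M F (\<lambda>x. ennreal (g x))"
  have "(\<integral>\<^sup>+x. ?E x \<partial>M) = (\<integral>\<^sup>+x. ennreal (g x) \<partial>M)"
    using nn_cond_exp_intg[of "\<lambda>x. 1" "\<lambda>x. ennreal (g x)"] by simp
  also have "\<dots> < \<infinity>"
    using g nonneg by (simp add: integrable_iff_bounded)
  finally have int: "(\<integral>\<^sup>+x. ?E x \<partial>M) < \<infinity>" .
  then show fin: "AE x in M. ?E x < \<infinity>"
    using nn_integral_noteq_infinite[of ?E M] by (simp add: less_top)
  show "integrable M (\<lambda>x. enn2real (?E x))"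
  proof (rule integrableI_nonneg)
    have "(\<integral>\<^sup>+x. ennreal (enn2real (?E x)) \<partial>M) = (\<integral>\<^sup>+x. ?E x \<partial>M)"
      by (rule nn_integral_cong_AE) (use fin in auto)
    with int show "(\<integral>\<^sup>+x. ennreal (enn2real (?E x)) \<partial>M) < \<infinity>" by simp
  qed auto
qed

lemma nn_cond_exp_mult_L2:
  assumes [measurable]: "v \<in> borel_measurable M" and "\<And>x. 0 \<le> v x" "0 < C"
    and "AE x in M. nn_cond_exp M F (\<lambda>x. ennreal ((v x)\<^sup>2)) x \<le> ennreal C"
    and f: "f \<in> L2 M"
  shows "AE x in M. nn_cond_exp M F (\<lambda>x. ennreal (v x * cmod (f x))) x < \<infinity>"
    and "AE x in M. (enn2real (nn_cond_exp M F (\<lambda>x. ennreal (v x * cmod (f x))) x))\<^sup>2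
      \<le> C * enn2real (nn_cond_exp M F (\<lambda>x. ennreal ((cmod (f x))\<^sup>2)) x)"
proof -
  note [measurable] = L2_measurable[OF f]
  have h: "AE x in M. nn_cond_exp M F (\<lambda>x. ennreal ((cmod (f x))\<^sup>2)) x < \<infinity>"
    by (rule integrable_enn2real_nn_cond_exp(1)[OF L2_integrable[OF f]]) simp
  show "AE x in M. nn_cond_exp M F (\<lambda>x. ennreal (v x * cmod (f x))) x < \<infinity>"
    "AE x in M. (enn2real (nn_cond_exp M F (\<lambda>x. ennreal (v x * cmod (f x))) x))\<^sup>2
      \<le> C * enn2real (nn_cond_exp M F (\<lambda>x. ennreal ((cmod (f x))\<^sup>2)) x)"
    by (intro nn_cond_exp_Cauchy_Schwarz[OF assms(1) _ assms(2) _ assms(3,4) h]; simp)+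
qed

lemma real_cond_exp_abs_le:
  assumes [measurable]: "k \<in> borel_measurable M" "l \<in> borel_measurable M"
    and le: "\<And>x. \<bar>k x\<bar> \<le> l x"
    and fin: "AE x in M. nn_cond_exp M F (\<lambda>x. ennreal (l x)) x < \<infinity>"
  shows "AE x in M. nn_cond_exp M F (\<lambda>x. ennreal \<bar>k x\<bar>) x < \<infinity>"
    and "AE x in M. \<bar>real_cond_exp M F k x\<bar> \<le> enn2real (nn_cond_exp M F (\<lambda>x. ennreal (l x)) x)"
proof -
  have mono: "AE x in M. nn_cond_exp M F (\<lambda>x. ennreal \<bar>k x\<bar>) x \<le> nn_cond_exp M F (\<lambda>x. ennreal (l x)) x"
    by (rule nn_cond_exp_mono) (auto intro: ennreal_leI le)
  then show "AE x in M. nn_cond_exp M F (\<lambda>x. ennreal \<bar>k x\<bar>) x < \<infinity>"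
    using fin by eventually_elim (rule le_less_trans)
  have "AE x in M. ennreal \<bar>real_cond_exp M F k x\<bar> \<le> nn_cond_exp M F (\<lambda>x. ennreal \<bar>k x\<bar>) x"
    by (rule real_cond_exp_abs) measurable
  then show "AE x in M. \<bar>real_cond_exp M F k x\<bar> \<le> enn2real (nn_cond_exp M F (\<lambda>x. ennreal (l x)) x)"
    using mono fin
  proof eventually_elim
    case (elim x)
    then have "ennreal \<bar>real_cond_exp M F k x\<bar> \<le> nn_cond_exp M F (\<lambda>x. ennreal (l x)) x"
      by (blast intro: order_trans)
    from enn2real_mono[OF this] elim(3) show ?case by simp
  qed
qed

text \<open>
  The quotient \<open>E(v k) / E(v)\<close> is measurable with respect to the subalgebra, so it can be pulled out:
  \<open>E(v E(v k) / E(v)) = E(v k)\<close>.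
\<close>

lemma real_cond_exp_mult_residual_eq_0:
  assumes [measurable]: "v \<in> borel_measurable M" "k \<in> borel_measurable M"
    and v: "AE x in M. nn_cond_exp M F (\<lambda>x. ennreal \<bar>v x\<bar>) x < \<infinity>"
    and vk: "AE x in M. nn_cond_exp M F (\<lambda>x. ennreal \<bar>v x * k x\<bar>) x < \<infinity>"
    and nz: "AE x in M. real_cond_exp M F v x \<noteq> 0"
  shows "AE x in M. real_cond_exp M F
    (\<lambda>x. v x * (k x - real_cond_exp M F (\<lambda>y. v y * k y) x / real_cond_exp M F v x)) x = 0"
proof -
  define e where "e = real_cond_exp M F (\<lambda>y. v y * k y)"
  define r where "r = real_cond_exp M F v"
  define a where "a = (\<lambda>x. - (e x / r x))"
  have a [measurable]: "a \<in> borel_measurable F"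
    unfolding a_def e_def r_def by measurable
  have [measurable]: "a \<in> borel_measurable M"
    using subalg a by (rule measurable_from_subalg)
  have prod: "AE x in M. ennreal \<bar>a x\<bar> * nn_cond_exp M F (\<lambda>x. ennreal \<bar>v x\<bar>) x
      = nn_cond_exp M F (\<lambda>x. ennreal \<bar>a x\<bar> * ennreal \<bar>v x\<bar>) x"
    by (rule nn_cond_exp_prod) measurable
  have av: "AE x in M. nn_cond_exp M F (\<lambda>x. ennreal \<bar>a x * v x\<bar>) x < \<infinity>"
    using prod v
  proof eventually_elim
    case (elim x)
    have "nn_cond_exp M F (\<lambda>x. ennreal \<bar>a x\<bar> * ennreal \<bar>v x\<bar>) x < \<infinity>"
      unfolding elim(1)[symmetric] using elim(2) by (simp add: ennreal_mult_less_top)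
    then show ?case by (simp add: abs_mult ennreal_mult)
  qed
  have "AE x in M. real_cond_exp M F (\<lambda>x. v x * k x + a x * v x) x
      = real_cond_exp M F (\<lambda>x. v x * k x) x + real_cond_exp M F (\<lambda>x. a x * v x) x"
    by (rule real_cond_exp_add_finite[OF _ _ vk av]) measurable
  moreover have "AE x in M. real_cond_exp M F (\<lambda>x. a x * v x) x = a x * real_cond_exp M F v x"
    by (rule real_cond_exp_mult_finite[OF a _ v]) measurable
  moreover have "(\<lambda>x. v x * k x + a x * v x) = (\<lambda>x. v x * (k x - e x / r x))"
    by (auto simp: a_def algebra_simps)
  ultimately have "AE x in M. real_cond_exp M F (\<lambda>x. v x * (k x - e x / r x)) x = e x + a x * r x"
    unfolding e_def r_def by auto
  then show ?thesis
    using nz unfolding e_def[symmetric] r_def[symmetric]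
    by eventually_elim (simp add: a_def)
qed

section \<open>Lifting along the weighted conditional expectation\<close>

lemma EM_of_real:
  assumes [measurable]: "u \<in> borel_measurable M" "v \<in> borel_measurable M" "f \<in> borel_measurable M"
    and uv: "AE x in M. u x = complex_of_real (v x)"
  shows "AE x in M. EM M F u f x = Complex (real_cond_exp M F (\<lambda>x. v x * Re (f x)) x)
      (real_cond_exp M F (\<lambda>x. v x * Im (f x)) x)"
proof -
  have "AE x in M. real_cond_exp M F (\<lambda>x. Re (u x * f x)) x = real_cond_exp M F (\<lambda>x. v x * Re (f x)) x"
    by (rule real_cond_exp_cong) (use uv in auto)
  moreover have "AE x in M. real_cond_exp M F (\<lambda>x. Im (u x * f x)) x = real_cond_exp M F (\<lambda>x. v x * Im (f x)) x"
    by (rule real_cond_exp_cong) (use uv in auto)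
  ultimately show ?thesis
    unfolding EM_def complex_cond_exp_def by auto
qed

lemma EM_measurable [measurable]: "EM M F u f \<in> borel_measurable M"
  unfolding EM_def complex_cond_exp_def[abs_def] Complex_eq by measurable

text \<open>
  The conditional Cauchy-Schwarz inequality bounds \<open>\<bar>E(u f)\<bar>\<^sup>2\<close> by a multiple of
  \<open>E(\<bar>f\<bar>\<^sup>2)\<close>. The factor \<open>2\<close> comes from estimating real and imaginary part separately.
\<close>

lemma EM_L2:
  assumes [measurable]: "u \<in> borel_measurable M" "v \<in> borel_measurable M"
    and uv: "AE x in M. u x = complex_of_real (v x)"
    and v: "\<And>x. 0 \<le> v x" "0 < C"
      "AE x in M. nn_cond_exp M F (\<lambda>x. ennreal ((v x)\<^sup>2)) x \<le> ennreal C"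
    and f: "f \<in> L2 M"
  shows "EM M F u f \<in> L2 M"
proof (rule L2_dominated[OF EM_measurable])
  note [measurable] = L2_measurable[OF f]
  note CS = nn_cond_exp_mult_L2[OF assms(2) v f]
  let ?H = "\<lambda>x. enn2real (nn_cond_exp M F (\<lambda>x. ennreal ((cmod (f x))\<^sup>2)) x)"
  show "integrable M (\<lambda>x. 2 * (C * ?H x))"
    using integrable_enn2real_nn_cond_exp(2)[OF L2_integrable[OF f]] by simp
  have re: "AE x in M. \<bar>real_cond_exp M F (\<lambda>x. v x * Re (f x)) x\<bar>
      \<le> enn2real (nn_cond_exp M F (\<lambda>x. ennreal (v x * cmod (f x))) x)"
    by (rule real_cond_exp_abs_le(2)[OF _ _ _ CS(1)])
      (auto simp: abs_mult v abs_Re_le_cmod intro: mult_left_mono)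
  have im: "AE x in M. \<bar>real_cond_exp M F (\<lambda>x. v x * Im (f x)) x\<bar>
      \<le> enn2real (nn_cond_exp M F (\<lambda>x. ennreal (v x * cmod (f x))) x)"
    by (rule real_cond_exp_abs_le(2)[OF _ _ _ CS(1)])
      (auto simp: abs_mult v abs_Im_le_cmod intro: mult_left_mono)
  have eq: "AE x in M. EM M F u f x = Complex (real_cond_exp M F (\<lambda>x. v x * Re (f x)) x)
      (real_cond_exp M F (\<lambda>x. v x * Im (f x)) x)"
    by (rule EM_of_real[OF _ _ _ uv]) measurable
  show "AE x in M. (cmod (EM M F u f x))\<^sup>2 \<le> 2 * (C * ?H x)"
    using re im eq CS(2)
  proof eventually_elim
    case (elim x)
    define e where "e = enn2real (nn_cond_exp M F (\<lambda>x. ennreal (v x * cmod (f x))) x)"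
    note [simp] = elim(3)
    have "(cmod (EM M F u f x))\<^sup>2 = \<bar>real_cond_exp M F (\<lambda>x. v x * Re (f x)) x\<bar>\<^sup>2
        + \<bar>real_cond_exp M F (\<lambda>x. v x * Im (f x)) x\<bar>\<^sup>2"
      by (simp add: cmod_power2)
    also have "\<dots> \<le> e\<^sup>2 + e\<^sup>2"
      using elim(1,2) unfolding e_def by (intro add_mono power_mono) auto
    also have "\<dots> \<le> 2 * (C * ?H x)" using elim(4) unfolding e_def by simp
    finally show ?case .
  qed
qed

text \<open>
  Modulo the kernel of \<open>f \<mapsto> E(u f)\<close>, the vector \<open>f\<close> can be replaced by \<open>g = E(u f) / E(u)\<close>,
  and \<open>E(u) \<ge> \<delta>\<close> controls the norm of \<open>g\<close> by that of the image \<open>E(u f)\<close>.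
\<close>

lemma EM_bounded_lift:
  assumes u [measurable]: "u \<in> borel_measurable M" and v [measurable]: "v \<in> borel_measurable M"
    and uv: "AE x in M. u x = complex_of_real (v x)"
    and vC: "\<And>x. 0 \<le> v x" "0 < C"
      "AE x in M. nn_cond_exp M F (\<lambda>x. ennreal ((v x)\<^sup>2)) x \<le> ennreal C"
    and v1: "AE x in M. nn_cond_exp M F (\<lambda>x. ennreal (v x)) x < \<infinity>"
    and \<delta>: "0 < \<delta>" "AE x in M. \<delta> \<le> real_cond_exp M F v x"
    and f: "f \<in> L2 M"
  obtains g where "g \<in> L2 M" "L2_norm M g \<le> L2_norm M (EM M F u f) / \<delta>"
    "AE x in M. EM M F u (\<lambda>x. f x - g x) x = 0"
proof -
  note [measurable] = L2_measurable[OF f]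
  let ?a = "real_cond_exp M F (\<lambda>y. v y * Re (f y))" and ?b = "real_cond_exp M F (\<lambda>y. v y * Im (f y))"
  let ?r = "real_cond_exp M F v"
  define g where "g = (\<lambda>x. Complex (?a x / ?r x) (?b x / ?r x))"
  have [measurable]: "g \<in> borel_measurable M"
    unfolding g_def Complex_eq by measurable
  have eq: "AE x in M. EM M F u f x = Complex (?a x) (?b x)"
    by (rule EM_of_real[OF _ _ _ uv]) measurable
  have EL2: "EM M F u f \<in> L2 M" by (rule EM_L2[OF u v uv vC f])
  have "AE x in M. cmod (g x) \<le> cmod (complex_of_real (1 / \<delta>) * EM M F u f x)"
    using eq \<delta>(2)
  proof eventually_elim
    case (elim x)
    have "g x = EM M F u f x / complex_of_real (?r x)"
      unfolding g_def elim(1) by (simp add: complex_eq_iff)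
    then have "cmod (g x) = cmod (EM M F u f x) / ?r x"
      using elim(2) \<delta>(1) by (simp add: norm_divide)
    also have "\<dots> \<le> cmod (EM M F u f x) / \<delta>"
      using elim(2) \<delta>(1) by (intro divide_left_mono) auto
    finally show ?case using \<delta>(1) by (simp add: norm_mult norm_divide)
  qed
  note le = this
  have EL2': "(\<lambda>x. complex_of_real (1 / \<delta>) * EM M F u f x) \<in> L2 M"
    by (rule L2_cmult[OF EL2])
  have g: "g \<in> L2 M"
    by (rule L2_dominated[OF _ L2_integrable[OF EL2']]) (use le in \<open>auto intro: power_mono\<close>)
  have "L2_norm M g \<le> L2_norm M (EM M F u f) / \<delta>"
    using L2_norm_mono[OF EL2' g le] \<delta>(1) unfolding L2_norm_cmult by (simp add: norm_divide)
  moreover have "AE x in M. EM M F u (\<lambda>x. f x - g x) x = 0"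
  proof -
    note CS = nn_cond_exp_mult_L2(1)[OF v vC f]
    have v1': "AE x in M. nn_cond_exp M F (\<lambda>x. ennreal \<bar>v x\<bar>) x < \<infinity>"
      using v1 by (simp add: vC)
    have nz: "AE x in M. ?r x \<noteq> 0" using \<delta> by auto
    have re: "AE x in M. nn_cond_exp M F (\<lambda>x. ennreal \<bar>v x * Re (f x)\<bar>) x < \<infinity>"
      by (rule real_cond_exp_abs_le(1)[OF _ _ _ CS])
        (auto simp: abs_mult vC abs_Re_le_cmod intro: mult_left_mono)
    have im: "AE x in M. nn_cond_exp M F (\<lambda>x. ennreal \<bar>v x * Im (f x)\<bar>) x < \<infinity>"
      by (rule real_cond_exp_abs_le(1)[OF _ _ _ CS])
        (auto simp: abs_mult vC abs_Im_le_cmod intro: mult_left_mono)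
    have "AE x in M. EM M F u (\<lambda>x. f x - g x) x
        = Complex (real_cond_exp M F (\<lambda>x. v x * Re (f x - g x)) x)
            (real_cond_exp M F (\<lambda>x. v x * Im (f x - g x)) x)"
      by (rule EM_of_real[OF _ _ _ uv]) measurable
    moreover have "AE x in M. real_cond_exp M F (\<lambda>x. v x * (Re (f x) - ?a x / ?r x)) x = 0"
      by (rule real_cond_exp_mult_residual_eq_0[OF v _ v1' re nz]) measurable
    moreover have "AE x in M. real_cond_exp M F (\<lambda>x. v x * (Im (f x) - ?b x / ?r x)) x = 0"
      by (rule real_cond_exp_mult_residual_eq_0[OF v _ v1' im nz]) measurable
    ultimately show ?thesis
      by eventually_elim (simp add: g_def complex_eq_iff)
  qed
  ultimately show ?thesis using that g by blast
qed

end

section \<open>Majorization\<close>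

theorem proposition2p21:
  fixes M A :: "'a measure"
    and w u :: "'a \<Rightarrow> complex"
    and S :: "('a \<Rightarrow> complex) \<Rightarrow> ('a \<Rightarrow> complex)"
    and \<delta> :: real
  assumes "complete_measure M"
    and "sigma_finite_measure M"
    and "sigma_finite_subalgebra M A"
    and "w \<in> cond_exp_domain M A"
    and "u \<in> cond_exp_domain M A"
    and "\<exists>C::real. AE x in M. nn_cond_exp M A (\<lambda>y. ennreal ((cmod (u y))\<^sup>2)) x \<le> ennreal C"
    and "bounded_op M (MEM M A w u)"
    and "AE x in M. 0 \<le> u x"
    and "S \<in> Q_class M (MEM M A w u)"
    and "\<delta> > 0"
    and "AE x in M. complex_of_real \<delta> \<le> complex_cond_exp M A u x"
  shows "majorizes M (EM M A u) S"
proof -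
  interpret sigma_finite_subalgebra M A by fact
  define v where "v = (\<lambda>x. cmod (u x))"
  have u [measurable]: "u \<in> borel_measurable M"
    and v1: "AE x in M. nn_cond_exp M A (\<lambda>x. ennreal (v x)) x < \<infinity>"
    using assms(5) by (auto simp: cond_exp_domain_def v_def)
  have v [measurable]: "v \<in> borel_measurable M" unfolding v_def by measurable
  have uv: "AE x in M. u x = complex_of_real (v x)"
    using assms(8)
  proof eventually_elim
    case (elim x)
    then show ?case
      by (auto simp: less_eq_complex_def v_def complex_eq_iff cmod_eq_Re)
  qed
  obtain C0 where C0: "AE x in M. nn_cond_exp M A (\<lambda>y. ennreal ((cmod (u y))\<^sup>2)) x \<le> ennreal C0"
    using assms(6) by blast
  \<comment> \<open>The given bound may be nonpositive; the conditional Cauchy-Schwarz inequality divides by it.\<close>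
  define C where "C = max 1 C0"
  have "0 < C" by (simp add: C_def)
  have vC: "AE x in M. nn_cond_exp M A (\<lambda>x. ennreal ((v x)\<^sup>2)) x \<le> ennreal C"
    using C0
  proof eventually_elim
    case (elim x)
    also have "ennreal C0 \<le> ennreal C" by (simp add: C_def ennreal_leI)
    finally show ?case by (simp add: v_def)
  qed
  have "AE x in M. real_cond_exp M A (\<lambda>x. Re (u x)) x = real_cond_exp M A v x"
    by (rule real_cond_exp_cong) (use uv in auto)
  with assms(11) have \<delta>: "AE x in M. \<delta> \<le> real_cond_exp M A v x"
    by eventually_elim (simp add: less_eq_complex_def complex_cond_exp_def)
  have S: "bounded_op M S" using assms(9) by (simp add: Q_class_def)
  obtain K where K: "K \<ge> 0" "\<And>f. f \<in> L2 M \<Longrightarrow> L2_norm M (S f) \<le> K * L2_norm M f"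
    using bounded_op_boundE[OF S] by metis
  \<comment> \<open>The summand \<open>1\<close> keeps the majorization constant positive when \<open>K = 0\<close>.\<close>
  have "L2_norm M (S f) \<le> (K / \<delta> + 1) * L2_norm M (EM M A u f)" if f: "f \<in> L2 M" for f
  proof -
    obtain g where g: "g \<in> L2 M" "L2_norm M g \<le> L2_norm M (EM M A u f) / \<delta>"
      and ker: "AE x in M. EM M A u (\<lambda>x. f x - g x) x = 0"
      using EM_bounded_lift[OF u v uv _ \<open>0 < C\<close> vC v1 assms(10) \<delta> f] by (auto simp: v_def)
    have "AE x in M. MEM M A w u (\<lambda>x. f x - g x) x = 0"
      using ker by (auto simp: MEM_def)
    from Q_class_kernel[OF assms(7,9) L2_diff[OF f g(1)] this]
    have "AE x in M. S f x = S g x"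
      using bounded_op_diff_AE[OF S f g(1)] by auto
    then have "L2_norm M (S f) = L2_norm M (S g)"
      by (intro L2_norm_cong_AE bounded_op_L2[OF S] f g)
    also have "\<dots> \<le> K * (L2_norm M (EM M A u f) / \<delta>)"
      using K(2)[OF g(1)] mult_left_mono[OF g(2) K(1)] by linarith
    also have "\<dots> \<le> (K / \<delta> + 1) * L2_norm M (EM M A u f)"
      by (simp add: distrib_right)
    finally show ?thesis .
  qed
  moreover have "K / \<delta> + 1 > 0" using K(1) assms(10) by (simp add: add_nonneg_pos)
  ultimately show ?thesis unfolding majorizes_def by blast
qed

end
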